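(* Let $(X,\mathcal A)$ be a measurable space, $\mu$ a monotone measure on $\mathcal A$, and $A\in\mathcal A$. Let $\circ\colon[0,\infty]\times[0,\infty]\to[0,\infty]$ be a nondecreasing map such that $a\circ 0=0$ for all $a$ and such that $x\mapsto x\circ y$ is left-continuous for every fixed $y$. Let $H\colon[0,\infty]\to[0,\infty]$ and $f\colon X\to[0,\infty]$ be such that $f$ and $H(f)=H\circ f$ are $\mathcal A$-measurable, and suppose that $p:=\mathrm{Su}(f;A,\mu)<\infty$. (i) The following inequality holds: $$\int_{\circ,A}H(f)\,\mathrm d\mu\ \ge\ \Big[\big(H(p_-)\wedge\inf H([p,\infty])\big)\circ p\Big]\vee\Big[\inf H\circ\mu(A)\Big].$$ Equality holds here for $f=\mu(A)\mathbf 1_A$ if (for the corresponding $p$) $H$ is left-continuous at $p$ and $H(p)=\inf H([p,\infty])$. (ii) If $\mu$ is weakly subadditive on $A$, then $$\int_{\circ,A}H(f)\,\mathrm d\mu\ \ge\ \Big[\big(H(p_+)\wedge\inf H([0,p])\big)\circ(\mu(A)-p)\Big]\vee\Big[\inf H\circ\mu(A)\Big].$$ Equality holds here if $f=y_0\mathbf 1_A$, $H$ is right-continuous at $p$, $H(p)=\inf H([0,p])$, and $y_0$ is such that $H(y_0)=\inf H$.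
   Context: A monotone measure on $\mathcal A$ is a set function $\mu\colon\mathcal A\to[0,\infty]$ with $\mu(\emptyset)=0$ and $\mu(B)\le\mu(C)$ whenever $B\subset C$. A binary map $\circ$ is nondecreasing if $a\circ b\le c\circ d$ whenever $a\le c$ and $b\le d$. Notation: $a\wedge b=\min(a,b)$, $a\vee b=\max(a,b)$; $\mathbf 1_A$ is the indicator function of $A$. Generalized Sugeno integral: for measurable $g\colon X\to[0,\infty]$, $$\int_{\circ,A}g\,\mathrm d\mu=\sup_{t\in[0,\infty]}\big\{t\circ\mu(A\cap\{g\ge t\})\big\},\qquad \{g\ge t\}=\{x\in X: g(x)\ge t\}.$$ Sugeno integral: $\mathrm{Su}(g;A,\mu)=\sup_{t\ge0}\{t\wedge\mu(A\cap\{g\ge t\})\}$. $\mu$ is weakly subadditive on $A$ if $\mu(A)\le\mu(A\cap B)+\mu(A\cap B^c)$ for all $B\in\mathcal A$, where $B^c=X\setminus B$. $\inf H(D)=\inf_{y\in D}H(y)$ for $D\subset[0,\infty]$, and $\inf H=\inf H([0,\infty])$. The expression $\inf H\circ\mu(A)$ means $(\inf H)\circ\mu(A)$. Lower one-sided limits: $H(p_-)=\lim_{\varepsilon\to0^+}\inf H((p-\varepsilon,p))$ for $p>0$, with the convention $H(0_-)=0$, and $H(p_+)=\lim_{\varepsilon\to0^+}\inf H((p,p+\varepsilon))$. *)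

theory Defs
  imports "HOL-Analysis.Analysis"
begin

text \<open>A value of type \<^typ>\<open>'a measure\<close> serves here only as the measurable space
  (\<open>space M\<close>, \<open>sets M\<close>); the measure it carries is never used. A monotone measure is a separate
  set function, of which only the values on \<open>sets M\<close> matter.\<close>

definition monotone_measure :: "'a measure \<Rightarrow> ('a set \<Rightarrow> ennreal) \<Rightarrow> bool" where
  "monotone_measure M \<mu> \<longleftrightarrow>
     \<mu> {} = 0 \<and> (\<forall>B\<in>sets M. \<forall>C\<in>sets M. B \<subseteq> C \<longrightarrow> \<mu> B \<le> \<mu> C)"

definition weakly_subadditive_on :: "'a measure \<Rightarrow> ('a set \<Rightarrow> ennreal) \<Rightarrow> 'a set \<Rightarrow> bool" where
  "weakly_subadditive_on M \<mu> A \<longleftrightarrow>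
     (\<forall>B\<in>sets M. \<mu> A \<le> \<mu> (A \<inter> B) + \<mu> (A \<inter> (space M - B)))"

definition gen_sugeno_integral ::
  "(ennreal \<Rightarrow> ennreal \<Rightarrow> ennreal) \<Rightarrow> 'a measure \<Rightarrow> ('a set \<Rightarrow> ennreal) \<Rightarrow> 'a set
     \<Rightarrow> ('a \<Rightarrow> ennreal) \<Rightarrow> ennreal" where
  "gen_sugeno_integral opn M \<mu> A g = (SUP t. opn t (\<mu> (A \<inter> {x \<in> space M. g x \<ge> t})))"

text \<open>The supremum includes \<open>t = \<infinity>\<close>, which does not change its value when \<open>\<mu>\<close> is monotone.\<close>

definition sugeno_integral ::
  "'a measure \<Rightarrow> ('a set \<Rightarrow> ennreal) \<Rightarrow> 'a set \<Rightarrow> ('a \<Rightarrow> ennreal) \<Rightarrow> ennreal" where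
  "sugeno_integral M \<mu> A g = (SUP t. min t (\<mu> (A \<inter> {x \<in> space M. g x \<ge> t})))"

text \<open>Lower one-sided limits \<open>H(p\<^sub>-)\<close> and \<open>H(p\<^sub>+)\<close>, meant for \<open>p < \<infinity>\<close>. Subtraction on \<^typ>\<open>ennreal\<close>
  truncates at \<open>0\<close>, which is harmless because only small \<open>e > 0\<close> matter in the limit.\<close>

definition lower_left_limit :: "(ennreal \<Rightarrow> ennreal) \<Rightarrow> ennreal \<Rightarrow> ennreal" where
  "lower_left_limit H p =
     (if p = 0 then 0 else Lim (at_right 0) (\<lambda>e. INF y\<in>{p - e<..<p}. H y))"

definition lower_right_limit :: "(ennreal \<Rightarrow> ennreal) \<Rightarrow> ennreal \<Rightarrow> ennreal" where
  "lower_right_limit H p = Lim (at_right 0) (\<lambda>e. INF y\<in>{p<..<p + e}. H y)"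

end

theory Submission
  imports Defs
begin

text \<open>Put \<open>m t = \<mu> (A \<inter> {f \<ge> t})\<close>. The number \<open>p\<close> is where the nonincreasing \<open>m\<close> crosses the
  diagonal: \<open>m t \<ge> p\<close> for \<open>t < p\<close> and \<open>m t \<le> p\<close> for \<open>t > p\<close>. On \<open>{f \<ge> t}\<close> the function \<open>H \<circ> f\<close> is
  at least \<open>inf H([t, \<infinity>])\<close>; on \<open>{f < t}\<close>, whose measure for \<open>t > p\<close> is at least \<open>\<mu> A - p\<close> by weak
  subadditivity, it is at least \<open>inf H([0, t))\<close>. Letting \<open>t\<close> tend to \<open>p\<close> from the respective side,
  both infima increase, so left-continuity of the operation yields the bounds. If \<open>H \<circ> f\<close> is
  constant on \<open>A\<close>, the integral is explicit.\<close>

text \<open>Shrinking \<open>e\<close> raises \<open>g e\<close>, so the limit at 0 is a supremum.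
  In that form the one-sided limits can be pulled out of a left-continuous map.\<close>

lemma Lim_at_right_0_antimono:
  fixes g :: "ennreal \<Rightarrow> ennreal"
  assumes anti: "\<And>d e. 0 < d \<Longrightarrow> d \<le> e \<Longrightarrow> g e \<le> g d"
  shows "Lim (at_right 0) g = (SUP e\<in>{0<..}. g e)"
proof (rule tendsto_Lim)
  \<comment> \<open>\<open>Lim\<close> is a definite description, so the limit must be unique, which
    needs a nontrivial filter.\<close>
  show "\<not> trivial_limit (at_right (0::ennreal))"
    unfolding trivial_limit_def eventually_at_right[OF zero_less_one[where 'a = ennreal]]
    using dense[of "0::ennreal"] by blast
  show "(g \<longlongrightarrow> (SUP e\<in>{0<..}. g e)) (at_right 0)"
  proof (rule order_tendstoI)
    fix a assume "a < (SUP e\<in>{0<..}. g e)"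
    then obtain e where e: "0 < e" "a < g e"
      by (auto simp: less_SUP_iff)
    then have "a < g d" if "0 < d" "d < e" for d
      using anti[of d e] that by (simp add: less_le_trans)
    then show "\<forall>\<^sub>F d in at_right 0. a < g d"
      unfolding eventually_at_right[OF \<open>0 < e\<close>] using e(1) by blast
  next
    fix a assume "(SUP e\<in>{0<..}. g e) < a"
    then have "g d < a" if "0 < d" for d
      using SUP_upper[of d "{0<..}" g] that by (simp add: le_less_trans)
    then show "\<forall>\<^sub>F d in at_right 0. g d < a"
      by (auto simp: eventually_at_filter)
  qed
qed

lemma lower_left_limit_eq_SUP:
  assumes "p \<noteq> 0"
  shows "lower_left_limit H p = (SUP e\<in>{0<..}. INF y\<in>{p - e<..<p}. H y)"
proof -
  have "(INF y\<in>{p - e<..<p}. H y) \<le> (INF y\<in>{p - d<..<p}. H y)" if "d \<le> e" for d e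
    using ennreal_mono_minus[OF that, of p] by (intro INF_superset_mono) (auto dest: le_less_trans)
  then show ?thesis
    unfolding lower_left_limit_def using assms by (simp add: Lim_at_right_0_antimono)
qed

lemma lower_right_limit_eq_SUP:
  "lower_right_limit H p = (SUP e\<in>{0<..}. INF y\<in>{p<..<p + e}. H y)"
proof -
  have "(INF y\<in>{p<..<p + e}. H y) \<le> (INF y\<in>{p<..<p + d}. H y)" if "d \<le> e" for d e
    using add_left_mono[OF that, of p] by (intro INF_superset_mono) (auto elim!: less_le_trans)
  then show ?thesis
    unfolding lower_right_limit_def by (simp add: Lim_at_right_0_antimono)
qed

lemma lower_left_limit_ge_of_continuous:
  assumes p: "p \<noteq> 0" "p < \<infinity>" and cont: "continuous (at_left p) H"
  shows "H p \<le> lower_left_limit H p"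
proof (rule dense_le)
  fix a assume "a < H p"
  have "0 < p" using p by (simp add: zero_less_iff_neq_zero)
  have "(H \<longlongrightarrow> H p) (at_left p)"
    using cont by (simp add: continuous_within)
  then have "\<forall>\<^sub>F y in at_left p. a < H y"
    using \<open>a < H p\<close> by (rule order_tendstoD)
  then obtain b where b: "b < p" "\<And>y. b < y \<Longrightarrow> y < p \<Longrightarrow> a < H y"
    unfolding eventually_at_left[OF \<open>0 < p\<close>] by blast
  \<comment> \<open>The width \<open>e = p - b\<close> makes the interval start at \<open>b\<close>:
    \<open>p - (p - b) = b\<close> because \<open>b < p < \<infinity>\<close>.\<close>
  have "b \<le> p - (p - b)"
    using b(1) p(2) by (simp add: diff_diff_ennreal)
  then have "a \<le> (INF y\<in>{p - (p - b)<..<p}. H y)"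
    using b(2) by (intro INF_greatest) (auto intro!: less_imp_le)
  also have "\<dots> \<le> lower_left_limit H p"
    unfolding lower_left_limit_eq_SUP[OF p(1)]
    using b(1) by (intro SUP_upper) (simp add: diff_gr0_ennreal)
  finally show "a \<le> lower_left_limit H p" .
qed

text \<open>A nondecreasing left-continuous map commutes with suprema of nonempty sets, and so does
  \<open>min\<close> with a constant; hence a bound valid for each \<open>i\<close> passes to the
  supremum. Below, \<open>i\<close> is the width \<open>e\<close> of a one-sided interval.\<close>

lemma left_continuous_min_SUP_le:
  fixes F :: "ennreal \<Rightarrow> ennreal"
  assumes "mono F" and "\<And>x. continuous (at_left x) F" and "I \<noteq> {}"
    and le: "\<And>i. i \<in> I \<Longrightarrow> F (min (g i) c) \<le> C"
  shows "F (min (SUP i\<in>I. g i) c) \<le> C"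
proof -
  have "min (SUP i\<in>I. g i) c = Sup ((\<lambda>i. min (g i) c) ` I)"
    by (simp add: SUP_inf flip: inf_min)
  then have "F (min (SUP i\<in>I. g i) c) = (SUP s\<in>(\<lambda>i. min (g i) c) ` I. F s)"
    using continuous_at_Sup_mono[OF assms(1,2), of "(\<lambda>i. min (g i) c) ` I"] assms(3) by simp
  also have "\<dots> \<le> C"
    using le by (auto intro!: SUP_least)
  finally show ?thesis .
qed

lemma sugeno_integral_eq_gen: "sugeno_integral = gen_sugeno_integral min"
  by (simp add: fun_eq_iff sugeno_integral_def gen_sugeno_integral_def)

text \<open>The level set of \<open>g\<close> at \<open>c\<close> contains \<open>B\<close>, so the
  term \<open>t = c\<close> of the supremum already suffices. Every lower bound below is an
  instance, for a suitable choice of \<open>B\<close>, \<open>c\<close> and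
  \<open>q\<close>.\<close>

lemma gen_sugeno_integral_ge:
  assumes \<mu>: "monotone_measure M \<mu>" and A: "A \<in> sets M" and g: "g \<in> borel_measurable M"
    and opn: "\<And>a b c d. a \<le> c \<Longrightarrow> b \<le> d \<Longrightarrow> opn a b \<le> opn c d"
    and B: "B \<in> sets M" "B \<subseteq> A" and c: "\<And>x. x \<in> B \<Longrightarrow> c \<le> g x"
    and q: "q \<le> \<mu> B"
  shows "opn c q \<le> gen_sugeno_integral opn M \<mu> A g"
proof -
  let ?C = "A \<inter> {x \<in> space M. g x \<ge> c}"
  have "?C \<in> sets M" using A g by measurable
  moreover have "B \<subseteq> ?C" using B c sets.sets_into_space[OF B(1)] by auto
  ultimately have "\<mu> B \<le> \<mu> ?C"
    using \<mu> B(1) unfolding monotone_measure_def by blast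
  then have "opn c q \<le> opn c (\<mu> ?C)"
    using q by (intro opn) auto
  also have "\<dots> \<le> gen_sugeno_integral opn M \<mu> A g"
    unfolding gen_sugeno_integral_def by (rule SUP_upper) simp
  finally show ?thesis .
qed

text \<open>Inside \<open>A\<close> the level set is \<open>A\<close> for \<open>t \<le> c\<close>
  and empty for larger \<open>t\<close>, where the term vanishes; by monotonicity the supremum is
  attained at \<open>t = c\<close>.\<close>

lemma gen_sugeno_integral_const:
  assumes \<mu>: "monotone_measure M \<mu>" and A: "A \<in> sets M"
    and opn: "\<And>a b c d. a \<le> c \<Longrightarrow> b \<le> d \<Longrightarrow> opn a b \<le> opn c d" "\<And>a. opn a 0 = 0"
    and g: "\<And>x. x \<in> A \<Longrightarrow> g x = c"
  shows "gen_sugeno_integral opn M \<mu> A g = opn c (\<mu> A)"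
proof -
  have level: "A \<inter> {x \<in> space M. g x \<ge> t} = (if t \<le> c then A else {})" for t
    using g sets.sets_into_space[OF A] by auto
  have "\<mu> {} = 0" using \<mu> by (simp add: monotone_measure_def)
  then show ?thesis
    unfolding gen_sugeno_integral_def level
    by (intro antisym SUP_least SUP_upper2[where i = c]) (auto simp: opn)
qed

text \<open>Any \<open>u\<close> strictly between \<open>t\<close> and the integral is exceeded by
  some term, say at \<open>s\<close>. Then \<open>t < u < s\<close>, so the level set at
  \<open>s\<close>, of measure above \<open>u\<close>, lies in the one at \<open>t\<close>.\<close>

lemma measure_level_set_ge:
  assumes \<mu>: "monotone_measure M \<mu>" and A: "A \<in> sets M" and f: "f \<in> borel_measurable M"
    and t: "t < sugeno_integral M \<mu> A f"
  shows "sugeno_integral M \<mu> A f \<le> \<mu> (A \<inter> {x \<in> space M. f x \<ge> t})"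
proof (rule dense_le_bounded[OF t])
  fix u assume "t < u" and "u < sugeno_integral M \<mu> A f"
  then obtain s where s: "u < s" "u < \<mu> (A \<inter> {x \<in> space M. f x \<ge> s})"
    by (auto simp: sugeno_integral_def less_SUP_iff)
  have "A \<inter> {x \<in> space M. f x \<ge> r} \<in> sets M" for r
    using A f by measurable
  moreover have "A \<inter> {x \<in> space M. f x \<ge> s} \<subseteq> A \<inter> {x \<in> space M. f x \<ge> t}"
    using s(1) \<open>t < u\<close> by auto
  ultimately have "\<mu> (A \<inter> {x \<in> space M. f x \<ge> s}) \<le> \<mu> (A \<inter> {x \<in> space M. f x \<ge> t})"
    using \<mu> unfolding monotone_measure_def by blast
  then show "u \<le> \<mu> (A \<inter> {x \<in> space M. f x \<ge> t})"
    using s(2) by simp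
qed

text \<open>The term at \<open>t\<close> is a minimum lying below \<open>t\<close>, so it must be
  the measure.\<close>

lemma measure_level_set_le:
  assumes "sugeno_integral M \<mu> A f < t"
  shows "\<mu> (A \<inter> {x \<in> space M. f x \<ge> t}) \<le> sugeno_integral M \<mu> A f"
proof -
  have "min t (\<mu> (A \<inter> {x \<in> space M. f x \<ge> t})) \<le> sugeno_integral M \<mu> A f"
    unfolding sugeno_integral_def by (rule SUP_upper) simp
  then show ?thesis using assms by (auto simp: min_le_iff_disj)
qed

theorem theorem2p1:
  fixes M :: "'a measure"
    and \<mu> :: "'a set \<Rightarrow> ennreal"
    and A :: "'a set"
    and opn :: "ennreal \<Rightarrow> ennreal \<Rightarrow> ennreal" (infixl "\<odot>" 70)
    and H :: "ennreal \<Rightarrow> ennreal"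
    and f :: "'a \<Rightarrow> ennreal"
    and p :: ennreal
  assumes "monotone_measure M \<mu>"
    and "A \<in> sets M"
    and "\<And>a b c d. a \<le> c \<Longrightarrow> b \<le> d \<Longrightarrow> a \<odot> b \<le> c \<odot> d"
    and "\<And>a. a \<odot> 0 = 0"
    and "\<And>x y. continuous (at_left x) (\<lambda>z. z \<odot> y)"
    and "f \<in> borel_measurable M"
    and "H \<circ> f \<in> borel_measurable M"
    and "p = sugeno_integral M \<mu> A f"
    and "p < \<infinity>"
  shows
    "gen_sugeno_integral (\<odot>) M \<mu> A (H \<circ> f)
       \<ge> max (min (lower_left_limit H p) (INF y\<in>{p..}. H y) \<odot> p) ((INF y. H y) \<odot> \<mu> A)
     \<and> ((\<forall>x\<in>space M. f x = \<mu> A * indicator A x)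
          \<and> continuous (at_left p) H \<and> H p = (INF y\<in>{p..}. H y)
        \<longrightarrow> gen_sugeno_integral (\<odot>) M \<mu> A (H \<circ> f)
             = max (min (lower_left_limit H p) (INF y\<in>{p..}. H y) \<odot> p) ((INF y. H y) \<odot> \<mu> A))
     \<and> (weakly_subadditive_on M \<mu> A \<longrightarrow>
          gen_sugeno_integral (\<odot>) M \<mu> A (H \<circ> f)
            \<ge> max (min (lower_right_limit H p) (INF y\<in>{..p}. H y) \<odot> (\<mu> A - p))
                  ((INF y. H y) \<odot> \<mu> A)
          \<and> (\<forall>y0. (\<forall>x\<in>space M. f x = y0 * indicator A x)
               \<and> continuous (at_right p) H \<and> H p = (INF y\<in>{..p}. H y) \<and> H y0 = (INF y. H y)
             \<longrightarrow> gen_sugeno_integral (\<odot>) M \<mu> A (H \<circ> f)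
                  = max (min (lower_right_limit H p) (INF y\<in>{..p}. H y) \<odot> (\<mu> A - p))
                        ((INF y. H y) \<odot> \<mu> A)))"
proof -
  note \<mu> = assms(1) and A = assms(2) and mono_op = assms(3) and op_0 = assms(4)
    and f = assms(6) and Hf = assms(7) and p = assms(8) and p_fin = assms(9)
  let ?I = "gen_sugeno_integral (\<odot>) M \<mu> A (H \<circ> f)"
  let ?inf = "(INF y. H y) \<odot> \<mu> A"
  have pos: "{0::ennreal<..} \<noteq> {}"
    by (metis empty_iff greaterThan_iff zero_less_one)
  have mono_left: "mono (\<lambda>z. z \<odot> q)" for q
    by (auto intro!: monoI mono_op)
  have bound: "c \<odot> q \<le> ?I" if "B \<in> sets M" "B \<subseteq> A" "\<And>x. x \<in> B \<Longrightarrow> c \<le> H (f x)" "q \<le> \<mu> B" for B c q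
    by (rule gen_sugeno_integral_ge[OF \<mu> A Hf _ that(1,2) _ that(4)]) (simp_all add: mono_op that(3))
  have inf_le: "?inf \<le> ?I"
    by (rule bound[OF A]) (auto intro: INF_lower)

  have left: "min (lower_left_limit H p) (INF y\<in>{p..}. H y) \<odot> p \<le> ?I"
  proof (cases "p = 0")
    \<comment> \<open>Here \<open>lower_left_limit\<close> is a convention rather than a supremum,
      but the right operand is 0.\<close>
    case True
    then show ?thesis by (simp add: op_0)
  next
    case False
    show ?thesis
      unfolding lower_left_limit_eq_SUP[OF False]
    proof (rule left_continuous_min_SUP_le[OF mono_left assms(5)])
      fix e :: ennreal assume "e \<in> {0<..}"
      then have "p - e < p"
        using False p_fin by (intro ennreal_between) (auto simp: zero_less_iff_neq_zero)
      then obtain t where t: "p - e < t" "t < p"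
        using dense by blast
      let ?c = "min (INF y\<in>{p - e<..<p}. H y) (INF y\<in>{p..}. H y)"
      \<comment> \<open>As \<open>t > p - e\<close>, such a \<open>y\<close> lies in
        \<open>(p - e, p)\<close> or in \<open>[p, \<infinity>]\<close>.\<close>
      have "?c \<le> H y" if "t \<le> y" for y
        using that t by (cases "y < p") (auto simp: min_le_iff_disj intro: INF_lower)
      moreover have "p \<le> \<mu> (A \<inter> {x \<in> space M. f x \<ge> t})"
        using measure_level_set_ge[OF \<mu> A f] t(2) unfolding p by blast
      moreover have "A \<inter> {x \<in> space M. f x \<ge> t} \<in> sets M"
        using A f by measurable
      ultimately show "?c \<odot> p \<le> ?I"
        by (intro bound) auto
    qed (rule pos)
  qed

  have left_eq: "?I = max (min (lower_left_limit H p) (INF y\<in>{p..}. H y) \<odot> p) ?inf"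
    if f_eq: "\<forall>x\<in>space M. f x = \<mu> A * indicator A x"
      and cont: "continuous (at_left p) H" and Hp: "H p = (INF y\<in>{p..}. H y)"
  proof (rule antisym)
    have f_A: "f x = \<mu> A" if "x \<in> A" for x
      using f_eq that sets.sets_into_space[OF A] by auto
    \<comment> \<open>Thus \<open>p = \<mu> A\<close> is also the value of \<open>f\<close> on
      \<open>A\<close>, and \<open>H \<circ> f\<close> is constantly \<open>H p\<close>
      there.\<close>
    have "p = min (\<mu> A) (\<mu> A)"
      unfolding p sugeno_integral_eq_gen
      by (rule gen_sugeno_integral_const[OF \<mu> A _ _ f_A]) (auto simp: min_le_iff_disj)
    then have "?I = H p \<odot> p"
      by (subst gen_sugeno_integral_const[OF \<mu> A, where c = "H p"]) (auto simp: mono_op op_0 f_A)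
    also have "\<dots> \<le> min (lower_left_limit H p) (INF y\<in>{p..}. H y) \<odot> p"
    proof (cases "p = 0")
      case True
      then show ?thesis by (simp add: op_0)
    next
      case False
      then show ?thesis
        using lower_left_limit_ge_of_continuous[OF False p_fin cont] Hp by (intro mono_op) auto
    qed
    finally show "?I \<le> max (min (lower_left_limit H p) (INF y\<in>{p..}. H y) \<odot> p) ?inf"
      by (simp add: le_max_iff_disj)
  qed (use left inf_le in simp)

  have right: "min (lower_right_limit H p) (INF y\<in>{..p}. H y) \<odot> (\<mu> A - p) \<le> ?I"
    if sub: "weakly_subadditive_on M \<mu> A"
    unfolding lower_right_limit_eq_SUP
  proof (rule left_continuous_min_SUP_le[OF mono_left assms(5)])
    fix e :: ennreal assume "e \<in> {0<..}"
    then have "p < p + e"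
      using p_fin ennreal_add_left_cancel_less[of p 0 e] by simp
    then obtain t where t: "p < t" "t < p + e"
      using dense by blast
    let ?B = "{x \<in> space M. f x \<ge> t}"
    have B: "?B \<in> sets M"
      using f by measurable
    let ?c = "min (INF y\<in>{p<..<p + e}. H y) (INF y\<in>{..p}. H y)"
    \<comment> \<open>As \<open>t < p + e\<close>, such a \<open>y\<close> lies in
      \<open>[0, p]\<close> or in \<open>(p, p + e)\<close>.\<close>
    have "?c \<le> H y" if "y < t" for y
      using that t by (cases "p < y") (auto simp: min_le_iff_disj intro: INF_lower)
    moreover have "\<mu> A - p \<le> \<mu> (A \<inter> (space M - ?B))"
    proof -
      have "\<mu> A \<le> \<mu> (A \<inter> ?B) + \<mu> (A \<inter> (space M - ?B))"
        using sub B by (simp add: weakly_subadditive_on_def)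
      also have "\<dots> \<le> p + \<mu> (A \<inter> (space M - ?B))"
        using measure_level_set_le t(1) unfolding p by (blast intro: add_right_mono)
      \<comment> \<open>Finiteness of \<open>p\<close> rules out
        \<open>\<infinity> - \<infinity>\<close> when \<open>p\<close> is moved to the left.\<close>
      finally show ?thesis
        using p_fin by (auto simp: ennreal_minus_le_iff)
    qed
    moreover have "A \<inter> (space M - ?B) \<in> sets M"
      using A B by auto
    ultimately show "?c \<odot> (\<mu> A - p) \<le> ?I"
      by (intro bound[where B = "A \<inter> (space M - ?B)"]) (auto simp: not_le)
  qed (rule pos)

  have I_eq_inf: "?I = ?inf"
    if "\<forall>x\<in>space M. f x = y0 * indicator A x" and "H y0 = (INF y. H y)" for y0
    using that sets.sets_into_space[OF A]
    by (intro gen_sugeno_integral_const[OF \<mu> A]) (auto simp: mono_op op_0)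

  \<comment> \<open>The integral equals the second entry of the maximum, and \<open>right\<close>
    bounds the first entry by the integral.\<close>
  have right_eq: "?I = max (min (lower_right_limit H p) (INF y\<in>{..p}. H y) \<odot> (\<mu> A - p)) ?inf"
    if "weakly_subadditive_on M \<mu> A" "\<forall>x\<in>space M. f x = y0 * indicator A x" "H y0 = (INF y. H y)"
    for y0
    using right[OF that(1)] I_eq_inf[OF that(2,3)] by (simp add: max_def)

  show ?thesis
    using left left_eq right right_eq inf_le by (intro conjI impI allI) auto
qed

end
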